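(* Let $n\ge1$, $X=\{1,\ldots,n\}$, and let $S$ be the vertex set of a permutograph on $S_n$. A function $F:S\to X$ is a discrete piecewise linear function if and only if it satisfies the separation property.
   Context: A permutation $\alpha$ of $X$ is written $\alpha=(x_1\cdots x_n)$ with $x_k=k\alpha$ (permutations act on the right and are composed left to right, so $x(\alpha\beta)=(x\alpha)\beta$). It defines the linear order $<_\alpha$ on $X$: $x_i<_\alpha x_j\iff i<j$; $\le_\alpha,\ge_\alpha$ accordingly. A pair $\{x,y\}\subseteq X$ is an inversion for $\{\alpha,\beta\}$ if $x,y$ appear in reverse order in $\alpha$ and $\beta$; the distance $d(\alpha,\beta)$ is the number of inversions. An ordered partition of $(X,<)$ is a partition $\pi=(X_1,\ldots,X_m)$ into nonempty sets such that $x\in X_i$, $y\in X_j$, $i<j$ imply $x<y$; it is trivial if it is $(\{1\},\ldots,\{n\})$. For a nontrivial ordered partition $\pi$, $\tau_\pi$ is the permutation reversing the order of the elements within each block $X_i$. Permutations $\alpha,\beta$ are $\pi$-adjacent if $\alpha\beta^{-1}=\tau_\pi$ for a nontrivial ordered partition $\pi$, and adjacent if they are $\pi$-adjacent for some such $\pi$. The big permutograph $\Upsilon_n$ is the graph on $S_n$ whose edges are the adjacent pairs, each edge $\alpha\beta$ having weight $d(\alpha,\beta)$. A permutograph on $S_n$ is an isometric weighted subgraph of $\Upsilon_n$, i.e. a subgraph such that for any two of its vertices $\alpha,\beta$ the minimum total weight of a path between them inside the subgraph equals their weighted path distance in $\Upsilon_n$ (which equals $d(\alpha,\beta)$). For a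 set $Y\subseteq X$, $Y\alpha=\{y\alpha:y\in Y\}$. A function $F:S\to X$ is a discrete piecewise linear function (DPL-function) if for any two $\pi$-adjacent permutations $\alpha,\beta\in S$ with $\pi=(X_1,\ldots,X_m)$ there is $1\le i\le m$ with $F(\alpha)\in X_i\alpha$ and $F(\beta)\in X_i\beta$. $F$ satisfies the separation property if for any $\alpha,\beta\in S$ there is $u\in X$ with $u\le_\alpha F(\alpha)$ and $u\ge_\beta F(\beta)$. *)

theory Defs
  imports
    "HOL-Combinatorics.Permutations"
    "HOL-Library.Disjoint_Sets"
    "Graph_Theory.Graph_Theory"
begin

text \<open>
  \<open>S\<^sub>n\<close> consists of the functions \<open>\<alpha>\<close> with \<open>\<alpha> permutes {1..n}\<close>; the right action \<open>k\<alpha>\<close> is \<open>\<alpha> k\<close>,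
  and the left-to-right product is \<open>x(\<alpha>\<beta>) = \<beta> (\<alpha> x)\<close>.
\<close>

definition perm_mult :: "(nat \<Rightarrow> nat) \<Rightarrow> (nat \<Rightarrow> nat) \<Rightarrow> nat \<Rightarrow> nat" (infixl \<open>\<cdot>\<^sub>r\<close> 70)
  where "\<alpha> \<cdot>\<^sub>r \<beta> = \<beta> \<circ> \<alpha>"

text \<open>With \<open>x\<^sub>k = \<alpha> k\<close>, the position of \<open>x\<close> in the word \<open>(x\<^sub>1 \<dots> x\<^sub>n)\<close> is \<open>inv \<alpha> x\<close>.\<close>

definition perm_less :: "(nat \<Rightarrow> nat) \<Rightarrow> nat \<Rightarrow> nat \<Rightarrow> bool"
  where "perm_less \<alpha> x y \<longleftrightarrow> inv \<alpha> x < inv \<alpha> y"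

definition perm_le :: "(nat \<Rightarrow> nat) \<Rightarrow> nat \<Rightarrow> nat \<Rightarrow> bool"
  where "perm_le \<alpha> x y \<longleftrightarrow> inv \<alpha> x \<le> inv \<alpha> y"

definition inversions :: "nat \<Rightarrow> (nat \<Rightarrow> nat) \<Rightarrow> (nat \<Rightarrow> nat) \<Rightarrow> nat set set"
  where "inversions n \<alpha> \<beta> =
    {{x, y} | x y. x \<in> {1..n} \<and> y \<in> {1..n} \<and> perm_less \<alpha> x y \<and> perm_less \<beta> y x}"

definition perm_dist :: "nat \<Rightarrow> (nat \<Rightarrow> nat) \<Rightarrow> (nat \<Rightarrow> nat) \<Rightarrow> nat"
  where "perm_dist n \<alpha> \<beta> = card (inversions n \<alpha> \<beta>)"

definition ordered_partition :: "nat \<Rightarrow> nat set list \<Rightarrow> bool"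
  where "ordered_partition n \<pi> \<longleftrightarrow>
    partition_on {1..n} (set \<pi>) \<and> sorted_wrt (\<lambda>A B. \<forall>x\<in>A. \<forall>y\<in>B. x < y) \<pi>"

definition trivial_partition :: "nat \<Rightarrow> nat set list"
  where "trivial_partition n = map (\<lambda>k. {k}) [1..<Suc n]"

definition nontrivial_ordered_partition :: "nat \<Rightarrow> nat set list \<Rightarrow> bool"
  where "nontrivial_ordered_partition n \<pi> \<longleftrightarrow> ordered_partition n \<pi> \<and> \<pi> \<noteq> trivial_partition n"

definition reverses_blocks :: "nat \<Rightarrow> nat set list \<Rightarrow> (nat \<Rightarrow> nat) \<Rightarrow> bool"
  where "reverses_blocks n \<pi> \<tau> \<longleftrightarrow>
    \<tau> permutes {1..n} \<and> (\<forall>B\<in>set \<pi>. \<tau> ` B = B \<and> strict_antimono_on B \<tau>)"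

text \<open>Well defined for ordered partitions by \<open>ex1_reverses_blocks\<close> below.\<close>

definition block_reversal :: "nat \<Rightarrow> nat set list \<Rightarrow> nat \<Rightarrow> nat"
  where "block_reversal n \<pi> = (THE \<tau>. reverses_blocks n \<pi> \<tau>)"

definition pi_adjacent :: "nat \<Rightarrow> nat set list \<Rightarrow> (nat \<Rightarrow> nat) \<Rightarrow> (nat \<Rightarrow> nat) \<Rightarrow> bool"
  where "pi_adjacent n \<pi> \<alpha> \<beta> \<longleftrightarrow>
    nontrivial_ordered_partition n \<pi> \<and> \<alpha> \<cdot>\<^sub>r inv \<beta> = block_reversal n \<pi>"

definition perm_adjacent :: "nat \<Rightarrow> (nat \<Rightarrow> nat) \<Rightarrow> (nat \<Rightarrow> nat) \<Rightarrow> bool"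
  where "perm_adjacent n \<alpha> \<beta> \<longleftrightarrow> (\<exists>\<pi>. pi_adjacent n \<pi> \<alpha> \<beta>)"

text \<open>Undirected graphs are symmetric digraphs; see \<open>pair_graph_big_permutograph\<close> below.\<close>

definition big_permutograph :: "nat \<Rightarrow> (nat \<Rightarrow> nat) pair_pre_digraph"
  where "big_permutograph n =
    \<lparr>pverts = {\<alpha>. \<alpha> permutes {1..n}},
     parcs = {(\<alpha>, \<beta>). \<alpha> permutes {1..n} \<and> \<beta> permutes {1..n} \<and> perm_adjacent n \<alpha> \<beta>}\<rparr>"

definition edge_weight :: "nat \<Rightarrow> (nat \<Rightarrow> nat) \<times> (nat \<Rightarrow> nat) \<Rightarrow> real"
  where "edge_weight n = (\<lambda>(\<alpha>, \<beta>). real (perm_dist n \<alpha> \<beta>))"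

text \<open>
  \<open>wf_digraph.\<mu>\<close> is the least cost of a walk between two vertices, and \<open>\<infinity>\<close> if there is none.
\<close>

definition permutograph :: "nat \<Rightarrow> (nat \<Rightarrow> nat) pair_pre_digraph \<Rightarrow> bool"
  where "permutograph n H \<longleftrightarrow>
    subgraph (with_proj H) (with_proj (big_permutograph n)) \<and>
    symmetric (with_proj H) \<and>
    (\<forall>\<alpha>\<in>pverts H. \<forall>\<beta>\<in>pverts H.
      wf_digraph.\<mu> (with_proj H) (edge_weight n) \<alpha> \<beta> =
      wf_digraph.\<mu> (with_proj (big_permutograph n)) (edge_weight n) \<alpha> \<beta>)"

definition DPL_function :: "nat \<Rightarrow> (nat \<Rightarrow> nat) set \<Rightarrow> ((nat \<Rightarrow> nat) \<Rightarrow> nat) \<Rightarrow> bool"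
  where "DPL_function n S F \<longleftrightarrow>
    (\<forall>\<alpha>\<in>S. \<forall>\<beta>\<in>S. \<forall>\<pi>. pi_adjacent n \<pi> \<alpha> \<beta> \<longrightarrow>
      (\<exists>i<length \<pi>. F \<alpha> \<in> \<alpha> ` (\<pi> ! i) \<and> F \<beta> \<in> \<beta> ` (\<pi> ! i)))"

definition separation_property :: "nat \<Rightarrow> (nat \<Rightarrow> nat) set \<Rightarrow> ((nat \<Rightarrow> nat) \<Rightarrow> nat) \<Rightarrow> bool"
  where "separation_property n S F \<longleftrightarrow>
    (\<forall>\<alpha>\<in>S. \<forall>\<beta>\<in>S. \<exists>u\<in>{1..n}. perm_le \<alpha> u (F \<alpha>) \<and> perm_le \<beta> (F \<beta>) u)"

lemma ordered_partition_cmp: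
  assumes "ordered_partition n \<pi>" "A \<in> set \<pi>" "B \<in> set \<pi>" "A \<noteq> B"
  shows "(\<forall>x\<in>A. \<forall>y\<in>B. x < y) \<or> (\<forall>x\<in>A. \<forall>y\<in>B. y < x)"
proof -
  obtain i j where ij: "i < length \<pi>" "A = \<pi> ! i" "j < length \<pi>" "B = \<pi> ! j"
    using assms(2,3) by (metis in_set_conv_nth)
  then have "i < j \<or> j < i" using assms(4) by (metis nat_neq_iff)
  moreover have s: "sorted_wrt (\<lambda>A B. \<forall>x\<in>A. \<forall>y\<in>B. x < y) \<pi>"
    using assms(1) by (simp add: ordered_partition_def)
  ultimately show ?thesis
    using ij sorted_wrt_nth_less[OF s, of i j] sorted_wrt_nth_less[OF s, of j i] by blast
qed

lemma ordered_partition_block_interval: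
  assumes "ordered_partition n \<pi>" "B \<in> set \<pi>"
  shows "finite B" "B \<noteq> {}" "B = {Min B..Max B}"
proof -
  have P: "partition_on {1..n} (set \<pi>)"
    using assms(1) by (simp add: ordered_partition_def)
  have sub: "B \<subseteq> {1..n}" using P assms(2) by (auto simp: partition_on_def)
  then show fin: "finite B" using finite_subset by blast
  show ne: "B \<noteq> {}" using P assms(2) by (auto simp: partition_on_def)
  have "z \<in> B" if z: "Min B \<le> z" "z \<le> Max B" for z
  proof (rule ccontr)
    assume "z \<notin> B"
    have "z \<in> {1..n}" using z sub Min_in[OF fin ne] Max_in[OF fin ne] by fastforce
    then obtain C where C: "C \<in> set \<pi>" "z \<in> C" using P unfolding partition_on_def by blast
    with \<open>z \<notin> B\<close> have "C \<noteq> B" by auto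
    from ordered_partition_cmp[OF assms(1) C(1) assms(2) this]
    show False using C(2) z Min_in[OF fin ne] Max_in[OF fin ne] by force
  qed
  then have "{Min B..Max B} \<subseteq> B" by auto
  moreover have "B \<subseteq> {Min B..Max B}" using fin by auto
  ultimately show "B = {Min B..Max B}" by (rule subset_antisym[rotated])
qed

lemma strict_antimono_image_unique:
  fixes f g :: "nat \<Rightarrow> nat"
  assumes "finite B" "f ` B = B" "g ` B = B" "strict_antimono_on B f" "strict_antimono_on B g"
    and "x \<in> B"
  shows "f x = g x"
proof -
  have rank: "{y \<in> B. y < h x} = h ` {z \<in> B. x < z} \<and> inj_on h B"
    if h: "h ` B = B" "strict_antimono_on B h" for h :: "nat \<Rightarrow> nat"
  proof -
    have lt: "h b < h a \<longleftrightarrow> a < b" if "a \<in> B" "b \<in> B" for a b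
      using h(2) that by (metis (mono_tags, lifting) monotone_onD less_asym nat_neq_iff)
    have "inj_on h B" using lt by (metis inj_onI less_irrefl nat_neq_iff)
    moreover have "{y \<in> B. y < h x} = h ` {z \<in> B. x < z}"
    proof (intro set_eqI iffI)
      fix y assume y: "y \<in> {y \<in> B. y < h x}"
      then obtain z where "z \<in> B" "y = h z" using h(1) by auto
      with y lt[OF assms(6)] show "y \<in> h ` {z \<in> B. x < z}" by auto
    next
      fix y assume "y \<in> h ` {z \<in> B. x < z}"
      then show "y \<in> {y \<in> B. y < h x}" using lt[OF assms(6)] h(1) by auto
    qed
    ultimately show ?thesis by simp
  qed
  have c: "card {y \<in> B. y < h x} = card {z \<in> B. x < z}"
    if h: "h ` B = B" "strict_antimono_on B h" for h :: "nat \<Rightarrow> nat"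
    using rank[OF h] by (metis (no_types, lifting) card_image inj_on_subset mem_Collect_eq subsetI)
  have mono: "card {y \<in> B. y < a} < card {y \<in> B. y < b}" if "a \<in> B" "a < b" for a b
    by (rule psubset_card_mono) (use assms(1) that in auto)
  have "f x \<in> B" "g x \<in> B" using assms(2,3,6) by auto
  moreover have "card {y \<in> B. y < f x} = card {y \<in> B. y < g x}"
    using c[OF assms(2,4)] c[OF assms(3,5)] by simp
  ultimately show ?thesis
    using mono[of "f x" "g x"] mono[of "g x" "f x"] by (cases "f x" "g x" rule: linorder_cases) auto
qed

lemma ex1_reverses_blocks:
  assumes "ordered_partition n \<pi>"
  shows "\<exists>!\<tau>. reverses_blocks n \<pi> \<tau>"
proof -
  have P: "partition_on {1..n} (set \<pi>)"
    using assms by (simp add: ordered_partition_def)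
  define blk where "blk x = (THE B. B \<in> set \<pi> \<and> x \<in> B)" for x
  have blk: "blk x = B" if "B \<in> set \<pi>" "x \<in> B" for x B
    unfolding blk_def
    by (rule the_equality) (use that P in \<open>auto simp: partition_on_def disjoint_def\<close>)
  define f where "f x = (if x \<in> {1..n} then Min (blk x) + Max (blk x) - x else x)" for x
  have inB: "x \<in> {1..n}" if "B \<in> set \<pi>" "x \<in> B" for x B
    using that P unfolding partition_on_def by blast
  have fB: "f x = Min B + Max B - x" if "B \<in> set \<pi>" "x \<in> B" for x B
    using blk[OF that] inB[OF that] by (simp add: f_def)
  have bd: "Min B \<le> x \<and> x \<le> Max B" if "B \<in> set \<pi>" "x \<in> B" for x B
    using ordered_partition_block_interval(1)[OF assms that(1)] that(2) by simp
  have fin: "f x \<in> B" if "B \<in> set \<pi>" "x \<in> B" for x B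
  proof -
    have "f x \<in> {Min B..Max B}" using fB[OF that] bd[OF that] by auto
    then show ?thesis using ordered_partition_block_interval(3)[OF assms that(1)] by simp
  qed
  have ffB: "f (f x) = x" if "B \<in> set \<pi>" "x \<in> B" for x B
    using fB[OF that] fB[OF that(1) fin[OF that]] bd[OF that] by simp
  have ff: "f (f x) = x" for x
  proof (cases "x \<in> {1..n}")
    case True
    then obtain B where "B \<in> set \<pi>" "x \<in> B" using P unfolding partition_on_def by blast
    then show ?thesis by (rule ffB)
  next
    case False
    then have "f x = x" unfolding f_def by (rule if_not_P)
    then show ?thesis by simp
  qed
  have "f permutes {1..n}"
    unfolding permutes_def
  proof (intro conjI allI impI)
    show "f x = x" if "x \<notin> {1..n}" for x
      using that unfolding f_def by (rule if_not_P)
    show "\<exists>!x. f x = y" for y using ff by metis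
  qed
  moreover have "f ` B = B" if "B \<in> set \<pi>" for B
  proof
    show "f ` B \<subseteq> B" using fin[OF that] by auto
    show "B \<subseteq> f ` B" using fin[OF that] ff by (metis imageI subsetI)
  qed
  moreover have "strict_antimono_on B f" if "B \<in> set \<pi>" for B
  proof (rule monotone_onI)
    fix x y assume xy: "x \<in> B" "y \<in> B" "x < y"
    show "f y < f x"
      using fB[OF that xy(1)] fB[OF that xy(2)] bd[OF that xy(1)] bd[OF that xy(2)] xy(3) by simp
  qed
  ultimately have ex: "reverses_blocks n \<pi> f" by (simp add: reverses_blocks_def)
  show ?thesis
  proof (rule ex1I[of _ f], rule ex)
    fix g assume g: "reverses_blocks n \<pi> g"
    show "g = f"
    proof
      fix x
      show "g x = f x"
      proof (cases "x \<in> {1..n}")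
        case True
        then obtain B where B: "B \<in> set \<pi>" "x \<in> B" using P unfolding partition_on_def by blast
        show ?thesis
          using strict_antimono_image_unique[of B g f x] B g ex
            ordered_partition_block_interval(1)[OF assms B(1)]
          by (simp add: reverses_blocks_def)
      next
        case False
        then show ?thesis
          using g ex unfolding reverses_blocks_def by (metis permutes_not_in)
      qed
    qed
  qed
qed

lemma reverses_block_reversal:
  assumes "ordered_partition n \<pi>"
  shows "reverses_blocks n \<pi> (block_reversal n \<pi>)"
proof -
  obtain \<tau> where t: "reverses_blocks n \<pi> \<tau>"
    and u: "\<And>\<sigma>. reverses_blocks n \<pi> \<sigma> \<Longrightarrow> \<sigma> = \<tau>"
    using ex1_reverses_blocks[OF assms] by (elim ex1E) blast
  then have "block_reversal n \<pi> = \<tau>"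
    unfolding block_reversal_def by (intro the_equality)
  with t show ?thesis by simp
qed

lemma inv_block_reversal:
  assumes "ordered_partition n \<pi>"
  shows "inv (block_reversal n \<pi>) = block_reversal n \<pi>"
proof -
  let ?t = "block_reversal n \<pi>"
  have r: "reverses_blocks n \<pi> ?t" by (rule reverses_block_reversal[OF assms])
  then have p: "?t permutes {1..n}" by (simp add: reverses_blocks_def)
  have "reverses_blocks n \<pi> (inv ?t)"
    unfolding reverses_blocks_def
  proof (intro conjI ballI)
    show "inv ?t permutes {1..n}" by (rule permutes_inv[OF p])
    fix B assume B: "B \<in> set \<pi>"
    then have tB: "?t ` B = B" "strict_antimono_on B ?t" using r by (auto simp: reverses_blocks_def)
    show iB: "inv ?t ` B = B"
      using tB(1) permutes_inj[OF p] by (metis image_inv_f_f)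
    show "strict_antimono_on B (inv ?t)"
    proof (rule monotone_onI)
      fix x y assume xy: "x \<in> B" "y \<in> B" "x < y"
      have m: "inv ?t x \<in> B" "inv ?t y \<in> B" using iB xy by auto
      have e: "?t (inv ?t x) = x" "?t (inv ?t y) = y" using permutes_inverses(1)[OF p] by auto
      show "inv ?t y < inv ?t x"
        using monotone_onD[OF tB(2) m] e xy(3)
        by (cases "inv ?t x" "inv ?t y" rule: linorder_cases) auto
    qed
  qed
  moreover obtain g where "\<And>\<tau>. reverses_blocks n \<pi> \<tau> \<Longrightarrow> \<tau> = g"
    using ex1_reverses_blocks[OF assms] by (elim ex1E) blast
  ultimately show ?thesis using r by metis
qed

lemma ordered_partition_singletons:
  assumes "ordered_partition n \<pi>" and single: "\<And>B. B \<in> set \<pi> \<Longrightarrow> \<exists>x. B = {x}"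
  shows "\<pi> = trivial_partition n"
proof -
  let ?xs = "map Min \<pi>"
  have eq: "B = {Min B}" if "B \<in> set \<pi>" for B using single[OF that] by auto
  have s: "sorted_wrt (\<lambda>A B. \<forall>x\<in>A. \<forall>y\<in>B. x < y) \<pi>" and P: "\<Union>(set \<pi>) = {1..n}"
    using assms(1) by (simp_all add: ordered_partition_def partition_on_def)
  have "sorted_wrt (<) ?xs"
    unfolding sorted_wrt_map
    by (rule sorted_wrt_mono_rel[OF _ s]) (metis eq singletonI)
  moreover have "set ?xs = set [1..<Suc n]"
  proof -
    have "set ?xs = \<Union>(set \<pi>)"
    proof (intro set_eqI iffI)
      fix x assume "x \<in> set ?xs"
      then show "x \<in> \<Union>(set \<pi>)" using eq by auto
    next
      fix x assume "x \<in> \<Union>(set \<pi>)"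
      then obtain B where "B \<in> set \<pi>" "x \<in> B" by blast
      then show "x \<in> set ?xs" using eq[of B] by auto
    qed
    then show ?thesis using P by auto
  qed
  ultimately have "?xs = [1..<Suc n]"
    by (metis strict_sorted_equal sorted_wrt_upt)
  moreover have "\<pi> = map (\<lambda>k. {k}) ?xs"
    using eq by (simp add: comp_def) (metis (no_types, lifting) map_idI)
  ultimately show ?thesis unfolding trivial_partition_def by simp
qed

lemma block_reversal_neq_id:
  assumes "nontrivial_ordered_partition n \<pi>"
  shows "block_reversal n \<pi> \<noteq> id"
proof
  assume "block_reversal n \<pi> = id"
  moreover have o: "ordered_partition n \<pi>"
    using assms by (simp add: nontrivial_ordered_partition_def)
  ultimately have am: "strict_antimono_on B id" if "B \<in> set \<pi>" for B :: "nat set"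
    using reverses_block_reversal[OF o] that by (simp add: reverses_blocks_def)
  have "\<exists>x. B = {x}" if B: "B \<in> set \<pi>" for B
  proof -
    obtain x where x: "x \<in> B" using ordered_partition_block_interval(2)[OF o B] by blast
    have "y = x" if "y \<in> B" for y
      using monotone_onD[OF am[OF B] x that] monotone_onD[OF am[OF B] that x]
      by (cases x y rule: linorder_cases) auto
    then show ?thesis using x by blast
  qed
  then show False
    using ordered_partition_singletons[OF o] assms by (simp add: nontrivial_ordered_partition_def)
qed

lemma pair_graph_big_permutograph: "pair_graph (big_permutograph n)"
proof -
  let ?V = "{\<alpha>. \<alpha> permutes {1..n}}"
  have fin: "finite ?V" by (rule finite_permutations) simp
  have sym: "perm_adjacent n \<beta> \<alpha>"
    if h: "\<alpha> permutes {1..n}" "\<beta> permutes {1..n}" "perm_adjacent n \<alpha> \<beta>" for \<alpha> \<beta>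
  proof -
    obtain \<pi> where \<pi>: "nontrivial_ordered_partition n \<pi>" "inv \<beta> \<circ> \<alpha> = block_reversal n \<pi>"
      using h(3) by (auto simp: perm_adjacent_def pi_adjacent_def perm_mult_def)
    have "inv \<alpha> \<circ> \<beta> = inv (inv \<beta> \<circ> \<alpha>)"
      using h(1,2) by (simp add: o_inv_distrib permutes_bij bij_imp_bij_inv inv_inv_eq)
    then show ?thesis
      using \<pi> inv_block_reversal[of n \<pi>]
      by (auto simp: perm_adjacent_def pi_adjacent_def perm_mult_def nontrivial_ordered_partition_def)
  qed
  have irr: "\<not> perm_adjacent n \<alpha> \<alpha>" if "\<alpha> permutes {1..n}" for \<alpha>
    using that
    by (auto simp: perm_adjacent_def pi_adjacent_def perm_mult_def permutes_inv_o
        dest: block_reversal_neq_id)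
  show ?thesis
  proof
    show "finite (parcs (big_permutograph n))"
      by (rule finite_subset[of _ "?V \<times> ?V"]) (use fin in \<open>auto simp: big_permutograph_def\<close>)
    show "symmetric (with_proj (big_permutograph n))"
      by (auto simp: symmetric_def big_permutograph_def sym_def intro: sym)
  qed (use fin irr in \<open>auto simp: big_permutograph_def\<close>)
qed

end

theory Submission
  imports Defs
begin

text \<open>
  Separation applied to both orders of an adjacent pair forces the two values of \<open>F\<close> into the same
  block. Conversely, sorting by adjacent transpositions shows that the weighted distance in the big
  permutograph is \<open>perm_dist\<close>, so any two vertices of a permutograph are joined by a walk inside it
  along which every pair of elements is swapped at most once. A separating element is carried
  backwards along such a walk: if \<open>u \<le>\<^sub>\<gamma> F \<gamma>\<close> but not \<open>u \<le>\<^sub>\<alpha> F \<alpha>\<close> for an edge from \<open>\<alpha>\<close> to \<open>\<gamma>\<close>, then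
  \<open>u\<close> and \<open>F \<alpha>\<close> are swapped on this edge and hence never again, so that \<open>F \<alpha>\<close> can replace \<open>u\<close>.
\<close>

section \<open>Inversions\<close>

lemma finite_inversions [simp]: "finite (inversions n \<alpha> \<beta>)"
  by (rule finite_subset[of _ "Pow {1..n}"]) (auto simp: inversions_def)

lemma pair_in_inversions_iff:
  assumes "x \<in> {1..n}" "y \<in> {1..n}"
  shows "{x, y} \<in> inversions n \<alpha> \<beta> \<longleftrightarrow>
    perm_less \<alpha> x y \<and> perm_less \<beta> y x \<or> perm_less \<alpha> y x \<and> perm_less \<beta> x y"
  using assms by (auto simp: inversions_def doubleton_eq_iff)

text \<open>The order of \<open>\<gamma>\<close> must agree with one of two opposite orders of a
  pair, so the pair is reversed on one of the two legs.\<close>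

lemma inversions_subset_Un:
  assumes "\<gamma> permutes {1..n}"
  shows "inversions n \<alpha> \<beta> \<subseteq> inversions n \<alpha> \<gamma> \<union> inversions n \<gamma> \<beta>"
proof
  fix e assume "e \<in> inversions n \<alpha> \<beta>"
  then obtain x y where e: "e = {x, y}" and xy: "x \<in> {1..n}" "y \<in> {1..n}"
    "perm_less \<alpha> x y" "perm_less \<beta> y x"
    unfolding inversions_def by blast
  have "x \<noteq> y" using xy(3) by (auto simp: perm_less_def)
  then have "inv \<gamma> x \<noteq> inv \<gamma> y" using permutes_inverses(1)[OF assms] by metis
  then have "perm_less \<gamma> x y \<or> perm_less \<gamma> y x" by (auto simp: perm_less_def)
  then show "e \<in> inversions n \<alpha> \<gamma> \<union> inversions n \<gamma> \<beta>"
    using xy by (auto simp: e pair_in_inversions_iff)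
qed

lemma perm_dist_triangle:
  assumes "\<gamma> permutes {1..n}"
  shows "perm_dist n \<alpha> \<beta> \<le> perm_dist n \<alpha> \<gamma> + perm_dist n \<gamma> \<beta>"
  unfolding perm_dist_def
  using card_mono[OF _ inversions_subset_Un[OF assms, of \<alpha> \<beta>]]
    card_Un_le[of "inversions n \<alpha> \<gamma>" "inversions n \<gamma> \<beta>"]
  by simp

text \<open>Equality in the triangle inequality leaves no room for overlap in
  \<open>inversions_subset_Un\<close>. On a geodesic this says that no pair is swapped
  twice.\<close>

lemma perm_dist_additive_imp_disjoint:
  assumes "\<gamma> permutes {1..n}" "perm_dist n \<alpha> \<gamma> + perm_dist n \<gamma> \<beta> \<le> perm_dist n \<alpha> \<beta>"
  shows "inversions n \<alpha> \<gamma> \<inter> inversions n \<gamma> \<beta> = {}"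
proof -
  let ?A = "inversions n \<alpha> \<gamma>" and ?B = "inversions n \<gamma> \<beta>"
  have "card ?A + card ?B \<le> card (?A \<union> ?B)"
    using assms(2) card_mono[OF _ inversions_subset_Un[OF assms(1), of \<alpha> \<beta>]]
    by (simp add: perm_dist_def)
  moreover have "card ?A + card ?B = card (?A \<union> ?B) + card (?A \<inter> ?B)"
    by (rule card_Un_Int) simp_all
  ultimately have "card (?A \<inter> ?B) = 0" by simp
  then show ?thesis by simp
qed

lemma perm_dist_self [simp]: "perm_dist n \<alpha> \<alpha> = 0"
proof -
  have "inversions n \<alpha> \<alpha> = {}" by (auto simp: inversions_def perm_less_def)
  then show ?thesis by (simp add: perm_dist_def)
qed

section \<open>Blocks of adjacent permutations\<close>

lemma permutes_in_image_iff:
  assumes "\<alpha> permutes S"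
  shows "x \<in> \<alpha> ` A \<longleftrightarrow> inv \<alpha> x \<in> A"
  by (metis assms image_iff permutes_inverses)

text \<open>Block reversals act on positions, not on elements: read left to right,
  \<open>\<alpha> \<cdot>\<^sub>r inv \<beta>\<close> sends a position in \<open>\<alpha>\<close> to
  the element there and then to its position in \<open>\<beta>\<close>.\<close>

lemma pi_adjacent_position:
  assumes "\<alpha> permutes {1..n}" "pi_adjacent n \<pi> \<alpha> \<beta>"
  shows "inv \<beta> x = block_reversal n \<pi> (inv \<alpha> x)"
proof -
  have "inv \<beta> \<circ> \<alpha> = block_reversal n \<pi>"
    using assms(2) by (simp add: pi_adjacent_def perm_mult_def)
  from fun_cong[OF this, of "inv \<alpha> x"] show ?thesis
    by (simp add: permutes_inverses[OF assms(1)])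
qed

lemma pi_adjacent_same_block:
  assumes "\<alpha> permutes {1..n}" "pi_adjacent n \<pi> \<alpha> \<beta>" "A \<in> set \<pi>" "inv \<alpha> x \<in> A"
  shows "inv \<beta> x \<in> A"
proof -
  have "ordered_partition n \<pi>"
    using assms(2) by (simp add: pi_adjacent_def nontrivial_ordered_partition_def)
  from reverses_block_reversal[OF this] have "block_reversal n \<pi> ` A = A"
    using assms(3) by (simp add: reverses_blocks_def)
  then show ?thesis using pi_adjacent_position[OF assms(1,2)] assms(4) by auto
qed

lemma pi_adjacent_reverses:
  assumes "\<alpha> permutes {1..n}" "pi_adjacent n \<pi> \<alpha> \<beta>" "A \<in> set \<pi>"
    and "inv \<alpha> x \<in> A" "inv \<alpha> y \<in> A" "perm_less \<alpha> x y"
  shows "perm_less \<beta> y x"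
proof -
  have "ordered_partition n \<pi>"
    using assms(2) by (simp add: pi_adjacent_def nontrivial_ordered_partition_def)
  from reverses_block_reversal[OF this] have "strict_antimono_on A (block_reversal n \<pi>)"
    using assms(3) by (simp add: reverses_blocks_def)
  from monotone_onD[OF this assms(4,5)] show ?thesis
    using assms(6) pi_adjacent_position[OF assms(1,2)] by (simp add: perm_less_def)
qed

section \<open>From separation to the discrete piecewise linear property\<close>

lemma ordered_partition_block_ex:
  assumes "ordered_partition n \<pi>" "x \<in> {1..n}"
  obtains A where "A \<in> set \<pi>" "x \<in> A"
  using assms unfolding ordered_partition_def partition_on_def by blast

text \<open>In the application \<open>c\<close> and \<open>c'\<close> are the positions of a
  separating element in the two permutations. If \<open>A\<close> preceded \<open>B\<close>, then
  \<open>C\<close>, meeting or preceding \<open>A\<close> because of \<open>c\<close>, could not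
  reach up to \<open>B\<close> with \<open>c'\<close>.\<close>

lemma ordered_partition_not_less_via:
  assumes "ordered_partition n \<pi>" "A \<in> set \<pi>" "C \<in> set \<pi>"
    and "a \<in> A" "b \<in> B" "c \<in> C" "c' \<in> C" "c \<le> a" "b \<le> c'"
  shows "\<not> (\<forall>x\<in>A. \<forall>y\<in>B. x < y)"
proof
  assume AB: "\<forall>x\<in>A. \<forall>y\<in>B. x < y"
  show False
  proof (cases "C = A")
    case True
    with AB assms(5,7,9) show False by force
  next
    case False
    from ordered_partition_cmp[OF assms(1,3,2) this] have "c' < a" using assms by force
    with AB assms show False by force
  qed
qed

lemma separation_property_imp_DPL_function:
  assumes S: "\<And>\<alpha>. \<alpha> \<in> S \<Longrightarrow> \<alpha> permutes {1..n}"
    and F: "F \<in> S \<rightarrow> {1..n}"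
    and sep: "separation_property n S F"
  shows "DPL_function n S F"
  unfolding DPL_function_def
proof (intro ballI allI impI)
  fix \<alpha> \<beta> \<pi> assume \<alpha>: "\<alpha> \<in> S" and \<beta>: "\<beta> \<in> S" and adj: "pi_adjacent n \<pi> \<alpha> \<beta>"
  note p\<alpha> = S[OF \<alpha>] and p\<beta> = S[OF \<beta>]
  have op: "ordered_partition n \<pi>"
    using adj by (simp add: pi_adjacent_def nontrivial_ordered_partition_def)
  have pos: "inv \<gamma> x \<in> {1..n}" if "\<gamma> permutes {1..n}" "x \<in> {1..n}" for \<gamma> x
    using permutes_in_image[OF permutes_inv[OF that(1)]] that(2) by blast
  obtain A where A: "A \<in> set \<pi>" "inv \<alpha> (F \<alpha>) \<in> A"
    using ordered_partition_block_ex[OF op pos[OF p\<alpha>, of "F \<alpha>"]] F \<alpha> by blast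
  obtain B where B: "B \<in> set \<pi>" "inv \<beta> (F \<beta>) \<in> B"
    using ordered_partition_block_ex[OF op pos[OF p\<beta>, of "F \<beta>"]] F \<beta> by blast
  \<comment> \<open>The reversal maps each block onto itself, so an element keeps its block when
    passing from \<open>\<alpha>\<close> to \<open>\<beta>\<close>.\<close>
  have block: "\<exists>C\<in>set \<pi>. inv \<alpha> u \<in> C \<and> inv \<beta> u \<in> C" if "u \<in> {1..n}" for u
    using ordered_partition_block_ex[OF op pos[OF p\<alpha> that]] pi_adjacent_same_block[OF p\<alpha> adj]
    by metis
  have "A = B"
  proof (rule ccontr)
    assume "A \<noteq> B"
    from ordered_partition_cmp[OF op A(1) B(1) this] show False
    proof
      assume lt: "\<forall>x\<in>A. \<forall>y\<in>B. x < y"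
      obtain u where u: "u \<in> {1..n}" "inv \<alpha> u \<le> inv \<alpha> (F \<alpha>)" "inv \<beta> (F \<beta>) \<le> inv \<beta> u"
        using sep \<alpha> \<beta> unfolding separation_property_def perm_le_def by blast
      from block[OF u(1)] ordered_partition_not_less_via[OF op A(1) _ A(2) B(2) _ _ u(2,3)] lt
      show False by blast
    next
      assume lt: "\<forall>x\<in>A. \<forall>y\<in>B. y < x"
      \<comment> \<open>Here separation is used for the pair in the opposite order, first
        \<open>\<beta>\<close> and then \<open>\<alpha>\<close>.\<close>
      obtain u where u: "u \<in> {1..n}" "inv \<beta> u \<le> inv \<beta> (F \<beta>)" "inv \<alpha> (F \<alpha>) \<le> inv \<alpha> u"
        using sep \<alpha> \<beta> unfolding separation_property_def perm_le_def by blast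
      from block[OF u(1)] ordered_partition_not_less_via[OF op B(1) _ B(2) A(2) _ _ u(2,3)] lt
      show False by blast
    qed
  qed
  then show "\<exists>i<length \<pi>. F \<alpha> \<in> \<alpha> ` (\<pi> ! i) \<and> F \<beta> \<in> \<beta> ` (\<pi> ! i)"
    using A B permutes_in_image_iff[OF p\<alpha>] permutes_in_image_iff[OF p\<beta>]
    by (metis in_set_conv_nth)
qed

section \<open>Distances in the big permutograph\<close>

text \<open>Starting from \<open>1 \<le> p 1\<close>, ascents give \<open>k \<le> p k\<close> by
  induction, and a permutation of \<open>{1..n}\<close> that lowers nothing is the identity. The
  contrapositive provides the descent needed for sorting.\<close>

lemma permutes_ascending_imp_id:
  assumes p: "p permutes {1..n}" and asc: "\<And>k. k \<in> {1..<n} \<Longrightarrow> p k < p (Suc k)"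
  shows "p = id"
proof (rule permutes_natset_ge[OF p], intro ballI)
  show "k \<le> p k" if "k \<in> {1..n}" for k
    using that
  proof (induction k)
    case 0
    then show ?case by simp
  next
    case (Suc k)
    show ?case
    proof (cases "k = 0")
      case True
      then show ?thesis using permutes_in_image[OF p, of "Suc k"] Suc.prems by simp
    next
      case False
      then show ?thesis using Suc asc[of k] by simp
    qed
  qed
qed

section \<open>Adjacent transpositions as edges\<close>

definition transposition_partition :: "nat \<Rightarrow> nat \<Rightarrow> nat set list"
  where "transposition_partition n k =
    map (\<lambda>i. {i}) [1..<k] @ {k, Suc k} # map (\<lambda>i. {i}) [Suc (Suc k)..<Suc n]"

lemma nontrivial_transposition_partition:
  assumes "k \<in> {1..<n}"
  shows "nontrivial_ordered_partition n (transposition_partition n k)"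
proof -
  let ?\<pi> = "transposition_partition n k"
  have set: "set ?\<pi> = insert {k, Suc k} ((\<lambda>i. {i}) ` ({1..n} - {k, Suc k}))"
  proof -
    have "{1..<k} \<union> {Suc (Suc k)..<Suc n} = {1..n} - {k, Suc k}" using assms by auto
    then show ?thesis
      by (simp add: transposition_partition_def image_Un[symmetric] del: upt_Suc)
  qed
  have "partition_on {1..n} (set ?\<pi>)"
    unfolding set using assms by (auto simp: partition_on_def disjoint_def)
  moreover have "sorted_wrt (\<lambda>A B. \<forall>x\<in>A. \<forall>y\<in>B. x < y) ?\<pi>"
    by (auto simp: transposition_partition_def sorted_wrt_append sorted_wrt_map
        simp del: upt_Suc)
  moreover have "?\<pi> \<noteq> trivial_partition n"
  proof
    assume "?\<pi> = trivial_partition n"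
    then have "{k, Suc k} \<in> set (trivial_partition n)" using set by auto
    then show False by (auto simp: trivial_partition_def doubleton_eq_iff simp del: upt_Suc)
  qed
  ultimately show ?thesis by (simp add: nontrivial_ordered_partition_def ordered_partition_def)
qed

text \<open>By the uniqueness in \<open>ex1_reverses_blocks\<close> it is enough that the
  transposition preserves and reverses every block; singletons are fixed.\<close>

lemma block_reversal_transposition_partition:
  assumes "k \<in> {1..<n}"
  shows "block_reversal n (transposition_partition n k) = transpose k (Suc k)"
proof -
  have "reverses_blocks n (transposition_partition n k) (transpose k (Suc k))"
    unfolding reverses_blocks_def
  proof (intro conjI ballI)
    show "transpose k (Suc k) permutes {1..n}"
      using assms by (intro permutes_swap_id) auto
    fix B assume "B \<in> set (transposition_partition n k)"
    then have "B = {k, Suc k} \<or> (\<exists>i. B = {i} \<and> i \<noteq> k \<and> i \<noteq> Suc k)"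
      unfolding transposition_partition_def set_append set_map set_upt list.set
      by (elim UnE insertE imageE) fastforce+
    then show "transpose k (Suc k) ` B = B" "strict_antimono_on B (transpose k (Suc k))"
      by (auto simp: monotone_on_def)
  qed
  moreover have "ordered_partition n (transposition_partition n k)"
    using nontrivial_transposition_partition[OF assms]
    by (simp add: nontrivial_ordered_partition_def)
  ultimately show ?thesis
    using ex1_reverses_blocks reverses_block_reversal by blast
qed

text \<open>Composing on this side acts on positions: it exchanges the neighbouring entries in
  places \<open>k\<close> and \<open>Suc k\<close> of the word of \<open>\<alpha>\<close>.\<close>

lemma perm_adjacent_transpose:
  assumes "\<alpha> permutes {1..n}" "k \<in> {1..<n}"
  shows "perm_adjacent n \<alpha> (\<alpha> \<circ> transpose k (Suc k))"
proof -
  have "inv (\<alpha> \<circ> transpose k (Suc k)) \<circ> \<alpha> = transpose k (Suc k) \<circ> (inv \<alpha> \<circ> \<alpha>)"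
    using permutes_bij[OF assms(1)] by (simp add: o_inv_distrib comp_assoc)
  also have "\<dots> = transpose k (Suc k)" using permutes_inv_o(2)[OF assms(1)] by simp
  finally show ?thesis
    unfolding perm_adjacent_def pi_adjacent_def perm_mult_def
    using nontrivial_transposition_partition[OF assms(2)]
      block_reversal_transposition_partition[OF assms(2)] by metis
qed

text \<open>No number lies between \<open>k\<close> and \<open>Suc k\<close>, so exchanging them
  affects no other comparison.\<close>

lemma transpose_Suc_less_iff:
  "transpose k (Suc k) i < transpose k (Suc k) j \<longleftrightarrow>
    (i < j \<and> \<not> (i = k \<and> j = Suc k)) \<or> (i = Suc k \<and> j = k)"
  by (auto simp: transpose_def)

lemma perm_less_comp_transpose_iff:
  assumes "\<alpha> permutes {1..n}"
  shows "perm_less (\<alpha> \<circ> transpose k (Suc k)) x y \<longleftrightarrow>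
    (perm_less \<alpha> x y \<and> \<not> (x = \<alpha> k \<and> y = \<alpha> (Suc k))) \<or> (x = \<alpha> (Suc k) \<and> y = \<alpha> k)"
proof -
  have "inv (\<alpha> \<circ> transpose k (Suc k)) z = transpose k (Suc k) (inv \<alpha> z)" for z
    using permutes_bij[OF assms] by (simp add: o_inv_distrib)
  moreover have "inv \<alpha> z = i \<longleftrightarrow> z = \<alpha> i" for z i
    using permutes_inverses[OF assms] by metis
  ultimately show ?thesis by (simp add: perm_less_def transpose_Suc_less_iff)
qed

lemma perm_dist_transpose_le:
  assumes "\<alpha> permutes {1..n}"
  shows "perm_dist n \<alpha> (\<alpha> \<circ> transpose k (Suc k)) \<le> 1"
proof -
  have "inversions n \<alpha> (\<alpha> \<circ> transpose k (Suc k)) \<subseteq> {{\<alpha> k, \<alpha> (Suc k)}}"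
    unfolding inversions_def perm_less_comp_transpose_iff[OF assms]
    by (auto simp: perm_less_def)
  from card_mono[OF _ this] show ?thesis by (simp add: perm_dist_def)
qed

text \<open>Exchanging neighbours that \<open>\<beta>\<close> orders the other way removes this one
  inversion and creates none.\<close>

lemma perm_dist_transpose_less:
  assumes \<alpha>: "\<alpha> permutes {1..n}" and k: "k \<in> {1..<n}"
    and desc: "perm_less \<beta> (\<alpha> (Suc k)) (\<alpha> k)"
  shows "perm_dist n (\<alpha> \<circ> transpose k (Suc k)) \<beta> < perm_dist n \<alpha> \<beta>"
proof -
  let ?a = "\<alpha> k" and ?b = "\<alpha> (Suc k)" and ?\<alpha>' = "\<alpha> \<circ> transpose k (Suc k)"
  have ab: "?a \<in> {1..n}" "?b \<in> {1..n}"
    using permutes_in_image[OF \<alpha>, of k] permutes_in_image[OF \<alpha>, of "Suc k"] k by auto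
  have less: "perm_less \<alpha> ?a ?b" by (simp add: perm_less_def permutes_inverses[OF \<alpha>])
  have "inversions n ?\<alpha>' \<beta> \<subseteq> inversions n \<alpha> \<beta>"
    unfolding inversions_def perm_less_comp_transpose_iff[OF \<alpha>]
    using desc by (auto simp: perm_less_def)
  moreover have "{?a, ?b} \<in> inversions n \<alpha> \<beta>"
    using ab less desc by (auto simp: pair_in_inversions_iff)
  moreover have "{?a, ?b} \<notin> inversions n ?\<alpha>' \<beta>"
    unfolding pair_in_inversions_iff[OF ab] perm_less_comp_transpose_iff[OF \<alpha>]
    using desc less by (auto simp: perm_less_def)
  ultimately have "inversions n ?\<alpha>' \<beta> \<subset> inversions n \<alpha> \<beta>" by blast
  from psubset_card_mono[OF _ this] show ?thesis by (simp add: perm_dist_def)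
qed

section \<open>Walks obtained by sorting\<close>

abbreviation walk_weight :: "nat \<Rightarrow> ((nat \<Rightarrow> nat) \<times> (nat \<Rightarrow> nat)) list \<Rightarrow> real"
  where "walk_weight n p \<equiv> sum_list (map (edge_weight n) p)"

lemma big_permutograph_simps [simp]:
  "pverts (big_permutograph n) = {\<alpha>. \<alpha> permutes {1..n}}"
  "parcs (big_permutograph n) =
    {(\<alpha>, \<beta>). \<alpha> permutes {1..n} \<and> \<beta> permutes {1..n} \<and> perm_adjacent n \<alpha> \<beta>}"
  by (simp_all add: big_permutograph_def)

text \<open>This is bubble sort of \<open>\<alpha>\<close> towards \<open>\<beta>\<close>: each
  exchange costs at most 1 and lowers the distance by at least 1, so the total cost is at most the
  initial distance.\<close>

lemma big_permutograph_awalk_ex: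
  assumes "\<alpha> permutes {1..n}" "\<beta> permutes {1..n}"
  shows "\<exists>p. pre_digraph.awalk (with_proj (big_permutograph n)) \<alpha> p \<beta> \<and>
    walk_weight n p \<le> real (perm_dist n \<alpha> \<beta>)"
  using assms(1)
proof (induction "perm_dist n \<alpha> \<beta>" arbitrary: \<alpha> rule: less_induct)
  case less
  interpret G: pair_graph "big_permutograph n" by (rule pair_graph_big_permutograph)
  show ?case
  proof (cases "\<alpha> = \<beta>")
    case True
    then have "G.awalk \<alpha> [] \<beta>" using less.prems by (simp add: G.awalk_Nil_iff)
    then show ?thesis by (intro exI[of _ "[]"]) simp
  next
    case False
    \<comment> \<open>This permutation lists the positions in \<open>\<beta>\<close> of the
      successive entries of \<open>\<alpha>\<close>; a descent of it is a neighbouring pair still to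
      be exchanged.\<close>
    have "inv \<beta> \<circ> \<alpha> permutes {1..n}"
      by (rule permutes_compose[OF less.prems permutes_inv[OF assms(2)]])
    moreover have "inv \<beta> \<circ> \<alpha> \<noteq> id"
      using False permutes_inverses(1)[OF assms(2)] by (metis comp_apply ext id_apply)
    ultimately obtain k where k: "k \<in> {1..<n}" "\<not> inv \<beta> (\<alpha> k) < inv \<beta> (\<alpha> (Suc k))"
      using permutes_ascending_imp_id[of "inv \<beta> \<circ> \<alpha>" n] by auto
    have "inv \<beta> (\<alpha> k) \<noteq> inv \<beta> (\<alpha> (Suc k))"
      using permutes_inverses(1)[OF assms(2)] permutes_inverses(2)[OF less.prems]
      by (metis n_not_Suc_n)
    with k have desc: "perm_less \<beta> (\<alpha> (Suc k)) (\<alpha> k)" by (simp add: perm_less_def)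
    let ?\<alpha>' = "\<alpha> \<circ> transpose k (Suc k)"
    have \<alpha>': "?\<alpha>' permutes {1..n}"
      using k(1) by (intro permutes_compose[OF permutes_swap_id less.prems]) auto
    note dec = perm_dist_transpose_less[OF less.prems k(1) desc]
    from less.hyps[OF dec \<alpha>'] obtain p where
      p: "G.awalk ?\<alpha>' p \<beta>" "walk_weight n p \<le> real (perm_dist n ?\<alpha>' \<beta>)"
      by blast
    have "G.awalk \<alpha> ((\<alpha>, ?\<alpha>') # p) \<beta>"
      using p(1) less.prems \<alpha>' perm_adjacent_transpose[OF less.prems k(1)]
      by (simp add: G.awalk_Cons_iff)
    moreover have "walk_weight n ((\<alpha>, ?\<alpha>') # p) \<le> real (perm_dist n \<alpha> \<beta>)"
      using p(2) dec perm_dist_transpose_le[OF less.prems, of k]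
      by (simp add: edge_weight_def)
    ultimately show ?thesis by blast
  qed
qed

section \<open>Geodesics in permutographs\<close>

text \<open>Integrality serves to sharpen a strict bound by \<open>d + 1\<close> to a bound by
  \<open>d\<close>.\<close>

lemma walk_weight_Nats: "\<exists>m. walk_weight n p = real m"
proof (induction p)
  case Nil
  show ?case by (intro exI[of _ 0]) simp
next
  case (Cons e p)
  then obtain m where "walk_weight n p = real m" by blast
  then show ?case
    by (intro exI[of _ "perm_dist n (fst e) (snd e) + m"])
      (simp add: edge_weight_def split: prod.split)
qed

text \<open>Isometry transfers the bound for the sorting walk from the big permutograph to
  \<open>H\<close>, where the sorting walk itself may be missing.\<close>

lemma permutograph_geodesic_ex:
  assumes H: "permutograph n H" and "\<alpha> \<in> pverts H" "\<beta> \<in> pverts H"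
  shows "\<exists>p. pre_digraph.awalk (with_proj H) \<alpha> p \<beta> \<and>
    walk_weight n p \<le> real (perm_dist n \<alpha> \<beta>)"
proof -
  interpret G: pair_graph "big_permutograph n" by (rule pair_graph_big_permutograph)
  interpret H: wf_digraph "with_proj H"
    using H by (simp add: permutograph_def subgraph_def)
  let ?d = "perm_dist n \<alpha> \<beta>"
  have "pverts H \<subseteq> {\<alpha>. \<alpha> permutes {1..n}}"
    using H by (simp add: permutograph_def subgraph_def)
  then obtain q where q: "G.awalk \<alpha> q \<beta>" "walk_weight n q \<le> real ?d"
    using big_permutograph_awalk_ex[of \<alpha> n \<beta>] assms(2,3) by blast
  have "H.\<mu> (edge_weight n) \<alpha> \<beta> = G.\<mu> (edge_weight n) \<alpha> \<beta>"
    using assms by (simp add: permutograph_def)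
  also have "\<dots> \<le> ereal (walk_weight n q)" 
    using G.min_cost_le_walk_cost[OF q(1)] by (simp add: G.awalk_cost_def)
  also have "\<dots> \<le> ereal (real ?d)" using q(2) by simp
  \<comment> \<open>The slack makes the bound strict, so the infimum yields an actual walk;
    integrality of its weight then removes the slack.\<close>
  also have "\<dots> < ereal (real ?d + 1)" by simp
  finally obtain p where p: "H.awalk \<alpha> p \<beta>" "walk_weight n p < real ?d + 1"
    unfolding H.\<mu>_def H.awalk_cost_def INF_less_iff by auto
  obtain m where "walk_weight n p = real m"
    using walk_weight_Nats by blast
  with p show ?thesis by auto
qed

section \<open>Carrying a separating element along a geodesic\<close>

text \<open>Here \<open>a\<close>, \<open>c\<close>, \<open>b\<close> stand for the values of
  \<open>F\<close> at \<open>\<alpha>\<close>, \<open>\<gamma>\<close>, \<open>\<beta>\<close>. The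
  disjunction says whether \<open>u\<close> still separates for \<open>\<alpha>\<close> and
  \<open>\<beta>\<close> or \<open>a\<close> takes its place.\<close>

lemma DPL_separation_step:
  assumes \<alpha>: "\<alpha> permutes {1..n}"
    and adj: "pi_adjacent n \<pi> \<alpha> \<gamma>"
    and A: "A \<in> set \<pi>" "inv \<alpha> a \<in> A" "inv \<gamma> c \<in> A"
    and geo: "inversions n \<alpha> \<gamma> \<inter> inversions n \<gamma> \<beta> = {}"
    and mem: "a \<in> {1..n}" "u \<in> {1..n}"
    and u: "perm_le \<gamma> u c" "perm_le \<beta> b u"
  shows "perm_le \<alpha> u a \<or> perm_le \<beta> b a"
proof (rule ccontr)
  assume "\<not> (perm_le \<alpha> u a \<or> perm_le \<beta> b a)"
  then have au: "inv \<alpha> a < inv \<alpha> u" and ab: "inv \<beta> a < inv \<beta> b"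
    by (auto simp: perm_le_def)
  have op: "ordered_partition n \<pi>"
    using adj by (simp add: pi_adjacent_def nontrivial_ordered_partition_def)
  have "inv \<alpha> u \<in> {1..n}" using permutes_in_image[OF permutes_inv[OF \<alpha>]] mem(2) by blast
  then obtain C where C: "C \<in> set \<pi>" "inv \<alpha> u \<in> C" by (rule ordered_partition_block_ex[OF op])
  have "inv \<gamma> u \<in> C" by (rule pi_adjacent_same_block[OF \<alpha> adj C])
  \<comment> \<open>In \<open>\<alpha>\<close> the element \<open>a\<close> precedes
    \<open>u\<close>, so a different block \<open>C\<close> would lie after \<open>A\<close>; but
    \<open>u\<close> does not come after \<open>c\<close> in \<open>\<gamma>\<close>.\<close>
  have "C = A"
  proof (rule ccontr)
    assume "C \<noteq> A"
    from ordered_partition_cmp[OF op C(1) A(1) this] show False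
      using A(2,3) C(2) \<open>inv \<gamma> u \<in> C\<close> au u(1) by (fastforce simp: perm_le_def)
  qed
  then have "perm_less \<gamma> u a"
    using pi_adjacent_reverses[OF \<alpha> adj A(1,2), of u] C(2) au by (simp add: perm_less_def)
  \<comment> \<open>In \<open>\<beta>\<close> the element \<open>a\<close> precedes
    \<open>b\<close>, which does not come after \<open>u\<close>, so the pair swapped on the edge is
    swapped back later.\<close>
  then have "{a, u} \<in> inversions n \<alpha> \<gamma> \<inter> inversions n \<gamma> \<beta>"
    using au ab u(2) mem by (auto simp: pair_in_inversions_iff perm_less_def perm_le_def)
  with geo show False by blast
qed

text \<open>Each edge weighs the distance of its ends, so this is the triangle inequality iterated
  along the walk.\<close>

lemma perm_dist_le_walk_weight:
  assumes sub: "subgraph (with_proj H) (with_proj (big_permutograph n))"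
    and "pre_digraph.awalk (with_proj H) \<alpha> p \<beta>"
  shows "real (perm_dist n \<alpha> \<beta>) \<le> walk_weight n p"
  using assms(2)
proof (induction p arbitrary: \<alpha>)
  interpret H: wf_digraph "with_proj H" using sub by (simp add: subgraph_def)
  {
    case Nil
    then show ?case by (simp add: H.awalk_Nil_iff)
  next
    case (Cons e p)
    then obtain \<gamma> where e: "e = (\<alpha>, \<gamma>)" "e \<in> parcs H" and p: "H.awalk \<gamma> p \<beta>"
      by (cases e) (auto simp: H.awalk_Cons_iff)
    have "\<gamma> permutes {1..n}" using sub e by (auto simp: subgraph_def)
    from perm_dist_triangle[OF this, of \<alpha> \<beta>] Cons.IH[OF p] show ?case
      by (simp add: e edge_weight_def)
  }
qed

lemma DPL_function_geodesic_separation: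
  assumes sub: "subgraph (with_proj H) (with_proj (big_permutograph n))"
    and F: "F \<in> pverts H \<rightarrow> {1..n}"
    and dpl: "DPL_function n (pverts H) F"
    and "pre_digraph.awalk (with_proj H) \<alpha> p \<beta>"
    and "walk_weight n p \<le> real (perm_dist n \<alpha> \<beta>)"
  shows "\<exists>u\<in>{1..n}. perm_le \<alpha> u (F \<alpha>) \<and> perm_le \<beta> (F \<beta>) u"
  using assms(4,5)
proof (induction p arbitrary: \<alpha>)
  interpret H: wf_digraph "with_proj H" using sub by (simp add: subgraph_def)
  {
    case Nil
    then have "\<alpha> = \<beta>" "\<alpha> \<in> pverts H" by (auto simp: H.awalk_Nil_iff)
    then show ?case using F by (intro bexI[of _ "F \<alpha>"]) (auto simp: perm_le_def)
  next
    case (Cons e p)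
    then obtain \<gamma> where e: "e = (\<alpha>, \<gamma>)" "e \<in> parcs H" and p: "H.awalk \<gamma> p \<beta>"
      by (cases e) (auto simp: H.awalk_Cons_iff)
    have perms: "\<alpha> permutes {1..n}" "\<gamma> permutes {1..n}" and "perm_adjacent n \<alpha> \<gamma>"
      using sub e by (auto simp: subgraph_def)
    then obtain \<pi> where adj: "pi_adjacent n \<pi> \<alpha> \<gamma>" by (auto simp: perm_adjacent_def)
    have verts: "\<alpha> \<in> pverts H" "\<gamma> \<in> pverts H"
      using H.awalk_hd_in_verts[OF Cons.prems(1)] H.awalk_hd_in_verts[OF p] by simp_all
    have cost: "real (perm_dist n \<alpha> \<gamma>) + walk_weight n p \<le> real (perm_dist n \<alpha> \<beta>)"
      using Cons.prems(2) by (simp add: e edge_weight_def)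
    \<comment> \<open>The rest of the walk costs at least the distance of its ends, so the triangle
      inequality through \<open>\<gamma>\<close> is an equality.\<close>
    then have "perm_dist n \<alpha> \<gamma> + perm_dist n \<gamma> \<beta> \<le> perm_dist n \<alpha> \<beta>"
      using perm_dist_le_walk_weight[OF sub p] by linarith
    note geo = perm_dist_additive_imp_disjoint[OF perms(2) this]
    \<comment> \<open>The tail of a geodesic is again a geodesic, which makes the induction
      hypothesis applicable.\<close>
    have "walk_weight n p \<le> real (perm_dist n \<gamma> \<beta>)"
      using cost perm_dist_triangle[OF perms(2), of \<alpha> \<beta>] by linarith
    from Cons.IH[OF p this] obtain u where
      u: "u \<in> {1..n}" "perm_le \<gamma> u (F \<gamma>)" "perm_le \<beta> (F \<beta>) u"
      by blast
    obtain A where A: "A \<in> set \<pi>" "inv \<alpha> (F \<alpha>) \<in> A" "inv \<gamma> (F \<gamma>) \<in> A"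
      using dpl verts adj unfolding DPL_function_def
      by (metis nth_mem permutes_in_image_iff[OF perms(1)] permutes_in_image_iff[OF perms(2)])
    have "F \<alpha> \<in> {1..n}" using F verts(1) by blast
    \<comment> \<open>The witness is \<open>u\<close> in the first case and
      \<open>F \<alpha>\<close> in the second.\<close>
    from DPL_separation_step[OF perms(1) adj A geo this u] show ?case
      using u \<open>F \<alpha> \<in> {1..n}\<close> by (auto simp: perm_le_def)
  }
qed

theorem theorem2:
  fixes n :: nat
    and H :: "(nat \<Rightarrow> nat) pair_pre_digraph"
    and S :: "(nat \<Rightarrow> nat) set"
    and F :: "(nat \<Rightarrow> nat) \<Rightarrow> nat"
  assumes "1 \<le> n"
    and "permutograph n H"
    and "S = pverts H"
    and "F \<in> S \<rightarrow> {1..n}"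
  shows "DPL_function n S F \<longleftrightarrow> separation_property n S F"
proof
  have sub: "subgraph (with_proj H) (with_proj (big_permutograph n))"
    using assms(2) by (simp add: permutograph_def)
  {
    assume "DPL_function n S F"
    with DPL_function_geodesic_separation[OF sub] permutograph_geodesic_ex[OF assms(2)] assms(3,4)
    show "separation_property n S F" unfolding separation_property_def by metis
  next
    assume "separation_property n S F"
    moreover have "\<alpha> permutes {1..n}" if "\<alpha> \<in> S" for \<alpha>
      using that sub assms(3) by (auto simp: subgraph_def)
    ultimately show "DPL_function n S F"
      using separation_property_imp_DPL_function assms(4) by blast
  }
qed

end
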